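(* Consider the full-gradient (semi-stochastic) subsampled Gauss-Newton / natural gradient Levenberg-Marquardt algorithm described in the context (that is, the subsampled algorithm with gradient mini-batch size $N_1=N$, step length $\alpha=1$, and with $\theta^{(t)}$ updated only when $\rho_t\ge\eta$, where $0<\eta<\epsilon$), applied to $f:\mathbb{R}^n\to\mathbb{R}$. Suppose that (i) there is a constant $\beta$ such that $\|B_t\|\le\beta$ for all iterations $t$; (ii) there is a constant $\beta_1$ such that $\|\nabla^2 f(\theta)\|\le\beta_1$ for all $\theta\in\mathbb{R}^n$; (iii) $f$ is bounded below. Then, unless the algorithm stops after finitely many iterations at a point with $g_t=0$, $$\lim_{t\to\infty}\|g_t\|=0,$$ where $g_t=\nabla f(\theta^{(t)})$.
   Context: Objective. $f(\theta)=\frac1N\sum_{i=1}^N f_i(\theta)$ for $\theta\in\mathbb{R}^n$, with $f_i(\theta)=\ell(\hat y_i(\theta),y_i)$, where $\hat y_i(\theta)\in\mathbb{R}^{m}$ is the output of a parametrized model (neural network) with parameters $\theta$ on data point $i$, and $\ell$ is a loss function. The functions are assumed smooth enough that the derivatives below exist; in particular $f$ is twice differentiable. $\|\cdot\|$ is the Euclidean norm for vectors and the induced spectral norm for matrices. Curvature matrices. At iteration $t$ a mini-batch $S_2^t\subseteq\{1,\dots,N\}$ of size $N_2$ is selected (randomly; the conclusion is for any choice of mini-batches). $B_t$ is one of the following two matrices (the same type being used throughout the run): - Gauss-Newton: $B_t=\frac1{N_2}\sum_{i\in S_2^t}J_i^\top H_iJ_i$ with $J_i=\frac{\partial\hat y_i}{\partial\theta}(\theta^{(t)})$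 and $H_i=\frac{\partial^2\ell(\hat y,y_i)}{\partial\hat y^2}\big|_{\hat y=\hat y_i(\theta^{(t)})}$, where the loss is such that $H_i\succeq0$; - Natural gradient (Fisher): $B_t=\frac1{N_2}\sum_{i\in S_2^t}\nabla f_i(\theta^{(t)})\nabla f_i(\theta^{(t)})^\top$. In both cases $B_t$ is symmetric positive semidefinite. Algorithm. Fixed parameters: $0<\epsilon<\frac12$, $0<\eta<\epsilon$, $\tau>0$, $0<drop<1<boost$. Start from $\theta^{(0)}\in\mathbb{R}^n$ and $\lambda_{\mathrm{LM}}^{(0)}>0$. For $t=0,1,2,\dots$: 1. Set $g_t=\nabla f(\theta^{(t)})$ (full gradient). If $g_t=0$, stop. 2. Set $\lambda_t=\lambda_{\mathrm{LM}}^{(t)}+\tau$ and $p_t=-(B_t+\lambda_tI)^{-1}g_t$. 3. With the quadratic model $m_t(p)=f(\theta^{(t)})+g_t^\top p+\frac12p^\top B_tp$, compute $$\rho_t=\frac{f(\theta^{(t)})-f(\theta^{(t)}+p_t)}{m_t(0)-m_t(p_t)}.$$ 4. Update the damping: if $\rho_t<\epsilon$, set $\lambda_{\mathrm{LM}}^{(t+1)}=boost\cdot\lambda_{\mathrm{LM}}^{(t)}$; else if $\rho_t>1-\epsilon$, set $\lambda_{\mathrm{LM}}^{(t+1)}=drop\cdot\lambda_{\mathrm{LM}}^{(t)}$; else $\lambda_{\mathrm{LM}}^{(t+1)}=\lambda_{\mathrm{LM}}^{(t)}$. 5. If $\rho_t\ge\eta$, set $\theta^{(t+1)}=\theta^{(t)}+p_t$;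 otherwise $\theta^{(t+1)}=\theta^{(t)}$. *)

theory Defs
  imports "HOL-Analysis.Analysis"
begin

definition gradient :: "(real^'n \<Rightarrow> real) \<Rightarrow> real^'n \<Rightarrow> real^'n" where
  "gradient f x = (THE D. GDERIV f x :> D)"

definition hessian :: "(real^'n \<Rightarrow> real) \<Rightarrow> real^'n \<Rightarrow> real^'n^'n" where
  "hessian f x = jacobian (gradient f) (at x)"

definition twice_differentiable_at :: "(real^'n \<Rightarrow> real) \<Rightarrow> real^'n \<Rightarrow> bool" where
  "twice_differentiable_at f x \<longleftrightarrow>
     (\<forall>\<^sub>F z in nhds x. f differentiable (at z)) \<and> gradient f differentiable (at x)"

definition spectral_norm :: "real^'n^'n \<Rightarrow> real" where
  "spectral_norm A = onorm ((*v) A)"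

definition pos_semidef :: "real^'n^'n \<Rightarrow> bool" where
  "pos_semidef A \<longleftrightarrow> transpose A = A \<and> (\<forall>x. 0 \<le> x \<bullet> (A *v x))"


text \<open>
  Data points are indexed by \<open>1, \<dots>, N\<close>; \<open>yhat i \<theta>\<close> is the model output on data point \<open>i\<close>,
  \<open>y i\<close> its label (of arbitrary type), and \<open>loss\<close> takes the output and the label.
\<close>

definition sample_loss ::
  "(nat \<Rightarrow> real^'n \<Rightarrow> real^'m) \<Rightarrow> (real^'m \<Rightarrow> 'y \<Rightarrow> real) \<Rightarrow> (nat \<Rightarrow> 'y) \<Rightarrow> nat \<Rightarrow> real^'n \<Rightarrow> real" where
  "sample_loss yhat loss y i \<theta> = loss (yhat i \<theta>) (y i)"

definition objective ::
  "(nat \<Rightarrow> real^'n \<Rightarrow> real^'m) \<Rightarrow> (real^'m \<Rightarrow> 'y \<Rightarrow> real) \<Rightarrow> (nat \<Rightarrow> 'y) \<Rightarrow> nat \<Rightarrow> real^'n \<Rightarrow> real" where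
  "objective yhat loss y N \<theta> = (1 / real N) * (\<Sum>i = 1..N. sample_loss yhat loss y i \<theta>)"

definition output_hessian ::
  "(nat \<Rightarrow> real^'n \<Rightarrow> real^'m) \<Rightarrow> (real^'m \<Rightarrow> 'y \<Rightarrow> real) \<Rightarrow> (nat \<Rightarrow> 'y) \<Rightarrow> nat \<Rightarrow> real^'n \<Rightarrow> real^'m^'m" where
  "output_hessian yhat loss y i \<theta> = hessian (\<lambda>z. loss z (y i)) (yhat i \<theta>)"

datatype curvature = Gauss_Newton | Fisher

fun curvature_matrix ::
  "curvature \<Rightarrow> (nat \<Rightarrow> real^'n \<Rightarrow> real^'m) \<Rightarrow> (real^'m \<Rightarrow> 'y \<Rightarrow> real) \<Rightarrow> (nat \<Rightarrow> 'y)
     \<Rightarrow> nat set \<Rightarrow> real^'n \<Rightarrow> real^'n^'n" where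
  "curvature_matrix Gauss_Newton yhat loss y S \<theta> =
     (1 / real (card S)) *\<^sub>R
       (\<Sum>i\<in>S. transpose (jacobian (yhat i) (at \<theta>)) ** output_hessian yhat loss y i \<theta>
                 ** jacobian (yhat i) (at \<theta>))"
| "curvature_matrix Fisher yhat loss y S \<theta> =
     (1 / real (card S)) *\<^sub>R
       (\<Sum>i\<in>S. (columnvector (gradient (sample_loss yhat loss y i) \<theta>) :: real^1^'n)
                 ** rowvector (gradient (sample_loss yhat loss y i) \<theta>))"

fun curvature_regular ::
  "curvature \<Rightarrow> (nat \<Rightarrow> real^'n \<Rightarrow> real^'m) \<Rightarrow> (real^'m \<Rightarrow> 'y \<Rightarrow> real) \<Rightarrow> (nat \<Rightarrow> 'y)
     \<Rightarrow> nat \<Rightarrow> real^'n \<Rightarrow> bool" where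
  "curvature_regular Gauss_Newton yhat loss y i \<theta> \<longleftrightarrow>
     yhat i differentiable (at \<theta>) \<and> twice_differentiable_at (\<lambda>z. loss z (y i)) (yhat i \<theta>)"
| "curvature_regular Fisher yhat loss y i \<theta> \<longleftrightarrow> sample_loss yhat loss y i differentiable (at \<theta>)"


definition lm_direction :: "real^'n^'n \<Rightarrow> real \<Rightarrow> real^'n \<Rightarrow> real^'n" where
  "lm_direction B lam g = - (matrix_inv (B + lam *\<^sub>R mat 1) *v g)"

definition quadratic_model ::
  "(real^'n \<Rightarrow> real) \<Rightarrow> real^'n^'n \<Rightarrow> real^'n \<Rightarrow> real^'n \<Rightarrow> real" where
  "quadratic_model f B \<theta> p = f \<theta> + gradient f \<theta> \<bullet> p + (1/2) * (p \<bullet> (B *v p))"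

definition reduction_ratio ::
  "(real^'n \<Rightarrow> real) \<Rightarrow> real^'n^'n \<Rightarrow> real^'n \<Rightarrow> real^'n \<Rightarrow> real" where
  "reduction_ratio f B \<theta> p =
     (f \<theta> - f (\<theta> + p)) / (quadratic_model f B \<theta> 0 - quadratic_model f B \<theta> p)"

definition update_damping :: "real \<Rightarrow> real \<Rightarrow> real \<Rightarrow> real \<Rightarrow> real \<Rightarrow> real" where
  "update_damping \<epsilon> shrink boost \<rho> lamLM =
     (if \<rho> < \<epsilon> then boost * lamLM else if \<rho> > 1 - \<epsilon> then shrink * lamLM else lamLM)"

text \<open>
  \<open>B t\<close> is the curvature matrix of iteration \<open>t\<close>. The algorithm halts as soon as the gradient
  vanishes, so the later entries of the sequences are left unconstrained.
\<close>

definition lm_run ::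
  "real \<Rightarrow> real \<Rightarrow> real \<Rightarrow> real \<Rightarrow> real \<Rightarrow> (real^'n \<Rightarrow> real) \<Rightarrow> (nat \<Rightarrow> real^'n^'n)
     \<Rightarrow> (nat \<Rightarrow> real^'n) \<Rightarrow> (nat \<Rightarrow> real) \<Rightarrow> bool" where
  "lm_run \<epsilon> \<eta> \<tau> shrink boost f B \<theta> lamLM \<longleftrightarrow>
     lamLM 0 > 0 \<and>
     (\<forall>t. (\<forall>s\<le>t. gradient f (\<theta> s) \<noteq> 0) \<longrightarrow>
       (let p = lm_direction (B t) (lamLM t + \<tau>) (gradient f (\<theta> t));
            \<rho> = reduction_ratio f (B t) (\<theta> t) p
        in lamLM (Suc t) = update_damping \<epsilon> shrink boost \<rho> (lamLM t) \<and>
           \<theta> (Suc t) = (if \<rho> \<ge> \<eta> then \<theta> t + p else \<theta> t)))"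

end

theory Submission
  imports Defs
begin

text \<open>
  Since \<open>g = -(B + \<lambda>I)p\<close>, the predicted reduction equals \<open>\<lambda>|p|\<^sup>2 + p\<^sup>TBp/2\<close>, whereas the actual
  reduction falls short of it by at most \<open>\<beta>\<^sub>1|p|\<^sup>2/2\<close>. Hence \<open>\<rho> \<ge> 1/2\<close> as soon as \<open>\<lambda> \<ge> \<beta>\<^sub>1\<close>, so the
  damping is never boosted beyond a fixed bound. A run of rejected steps boosts the damping
  geometrically, so every iteration is followed by an accepted step, taken from the same point.
  That step lowers \<open>f\<close> by at least a constant times \<open>|g\<^sub>t|\<^sup>2\<close>; as \<open>f(\<theta>\<^sub>t)\<close> is decreasing and bounded
  below, \<open>|g\<^sub>t|\<^sup>2\<close> is dominated by the distance of \<open>f(\<theta>\<^sub>t)\<close> to its limit.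
\<close>

section \<open>Gradients and the descent lemma\<close>

text \<open>Existence comes from the Riesz representation of the derivative in the standard basis.
  Uniqueness of the derivative then makes the definite description in \<open>gradient\<close>
  meaningful.\<close>

lemma GDERIV_gradient:
  fixes f :: "real^'n \<Rightarrow> real"
  assumes "f differentiable (at x)"
  shows "GDERIV f x :> gradient f x"
proof -
  obtain f' where f': "(f has_derivative f') (at x)"
    using assms by (auto simp: differentiable_def)
  then have lin: "linear f'" by (rule has_derivative_linear)
  define D where "D = (\<Sum>b\<in>Basis. f' b *\<^sub>R b)"
  have "f' h = h \<bullet> D" for h
  proof -
    have "f' h = f' (\<Sum>b\<in>Basis. (h \<bullet> b) *\<^sub>R b)" by (simp add: euclidean_representation)
    also have "\<dots> = (\<Sum>b\<in>Basis. (h \<bullet> b) * f' b)"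
      by (simp add: linear_sum[OF lin] linear_cmul[OF lin])
    finally show ?thesis by (simp add: D_def inner_sum_right mult.commute)
  qed
  then have "f' = (\<lambda>h. h \<bullet> D)" by auto
  with f' have D: "GDERIV f x :> D" by (simp add: gderiv_def)
  have "E = D" if "GDERIV f x :> E" for E
  proof -
    have "(\<lambda>h. h \<bullet> E) = (\<lambda>h. h \<bullet> D)"
      using that D unfolding gderiv_def by (rule has_derivative_unique)
    then show ?thesis by (simp add: fun_eq_iff vector_eq_ldot)
  qed
  with D show ?thesis unfolding gradient_def using theI[of "\<lambda>D. GDERIV f x :> D" D] by blast
qed

text \<open>This is the mean value inequality for the gradient map on the convex set
  \<open>UNIV\<close>, whose derivative is the Hessian.\<close>

lemma gradient_lipschitz:
  fixes f :: "real^'n \<Rightarrow> real"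
  assumes "\<And>x. twice_differentiable_at f x" "\<And>x. spectral_norm (hessian f x) \<le> L"
  shows "norm (gradient f x - gradient f y) \<le> L * norm (x - y)"
proof (rule differentiable_bound[where S = UNIV])
  show "(gradient f has_derivative (*v) (hessian f z)) (at z within UNIV)" for z
    using assms(1)[of z] unfolding twice_differentiable_at_def hessian_def
    by (simp add: jacobian_works)
  show "onorm ((*v) (hessian f z)) \<le> L" for z
    using assms(2)[of z] by (simp add: spectral_norm_def)
qed auto

lemma descent_lemma:
  fixes f :: "real^'n \<Rightarrow> real"
  assumes diff: "\<And>x. f differentiable (at x)"
    and lip: "\<And>x y. norm (gradient f x - gradient f y) \<le> L * norm (x - y)"
  shows "f (x + p) \<le> f x + gradient f x \<bullet> p + L / 2 * (norm p)\<^sup>2"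
proof -
  \<comment> \<open>Along the segment, \<open>\<phi>\<close> is \<open>f\<close> minus the
    non-constant part of the claimed upper bound, so the goal is exactly
    \<open>\<phi> 1 \<le> \<phi> 0\<close>. The Lipschitz bound and Cauchy-Schwarz make its
    derivative nonpositive on the unit interval.\<close>
  define \<phi> where "\<phi> s = f (x + s *\<^sub>R p) - s * (gradient f x \<bullet> p) - L / 2 * s\<^sup>2 * (norm p)\<^sup>2" for s
  have "\<phi> 1 \<le> \<phi> 0"
  proof (rule DERIV_nonpos_imp_nonincreasing[where f = \<phi> and a = 0 and b = 1])
    fix s :: real assume s: "0 \<le> s" "s \<le> 1"
    let ?g = "gradient f (x + s *\<^sub>R p)"
    have "(f has_derivative (\<lambda>h. h \<bullet> ?g)) (at (x + s *\<^sub>R p))"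
      using GDERIV_gradient[OF diff] by (simp add: gderiv_def)
    then have "((\<lambda>s. f (x + s *\<^sub>R p)) has_derivative (\<lambda>h. (h *\<^sub>R p) \<bullet> ?g)) (at s)"
      by (rule has_derivative_compose[rotated]) (auto intro!: derivative_eq_intros)
    then have "((\<lambda>s. f (x + s *\<^sub>R p)) has_real_derivative ?g \<bullet> p) (at s)"
      by (simp add: has_field_derivative_def inner_commute mult_commute_abs)
    then have "(\<phi> has_real_derivative ?g \<bullet> p - gradient f x \<bullet> p - L * s * (norm p)\<^sup>2) (at s)"
      unfolding \<phi>_def by (auto intro!: derivative_eq_intros)
    moreover have "?g \<bullet> p - gradient f x \<bullet> p \<le> L * s * (norm p)\<^sup>2"
    proof -
      have "?g \<bullet> p - gradient f x \<bullet> p \<le> norm (?g - gradient f x) * norm p"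
        by (metis inner_diff_left norm_cauchy_schwarz)
      also have "\<dots> \<le> (L * norm (s *\<^sub>R p)) * norm p"
        using lip[of "x + s *\<^sub>R p" x] by (intro mult_right_mono) auto
      finally show ?thesis using s by (simp add: power2_eq_square mult_ac)
    qed
    ultimately show "\<exists>y. (\<phi> has_real_derivative y) (at s) \<and> y \<le> 0"
      by (metis diff_le_0_iff_le)
  qed simp
  then show ?thesis by (simp add: \<phi>_def)
qed

section \<open>Curvature matrices and the damped step\<close>

lemma quadratic_form_columnvector_rowvector:
  fixes v x :: "real^'n"
  shows "x \<bullet> (((columnvector v :: real^1^'n) ** rowvector v) *v x) = (v \<bullet> x)\<^sup>2"
proof -
  have "((columnvector v :: real^1^'n) ** rowvector v) *v x = (v \<bullet> x) *\<^sub>R v"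
    by (simp add: vec_eq_iff matrix_vector_mult_def matrix_matrix_mult_def columnvector_def
        rowvector_def inner_vec_def sum_distrib_left mult_ac)
  then show ?thesis by (simp add: inner_commute power2_eq_square)
qed

lemma quadratic_form_congruence:
  fixes J :: "real^'n^'m" and H :: "real^'m^'m"
  shows "x \<bullet> ((transpose J ** H ** J) *v x) = (J *v x) \<bullet> (H *v (J *v x))"
  by (simp add: dot_lmul_matrix[symmetric] matrix_vector_mul_assoc[symmetric] vector_transpose_matrix
      flip: transpose_matrix_vector)

lemma matrix_vector_mult_sum:
  fixes A :: "'i \<Rightarrow> real^'n^'m"
  shows "(\<Sum>i\<in>I. A i) *v x = (\<Sum>i\<in>I. A i *v x)"
  by (induction I rule: infinite_finite_induct) (auto simp: matrix_vector_mult_add_rdistrib)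

text \<open>Each summand contributes a square in the Fisher case, and the form of a semidefinite
  \<open>H\<close> evaluated at \<open>J *v x\<close> in the Gauss-Newton case. From here on the two
  kinds of curvature are treated alike.\<close>

lemma curvature_matrix_nonneg:
  assumes "\<And>i. kind = Gauss_Newton \<Longrightarrow> i \<in> S \<Longrightarrow> pos_semidef (output_hessian yhat loss y i \<theta>)"
  shows "0 \<le> x \<bullet> (curvature_matrix kind yhat loss y S \<theta> *v x)"
proof (cases kind)
  case Gauss_Newton
  then show ?thesis
    using assms
    by (auto simp: scaleR_matrix_vector_assoc[symmetric] matrix_vector_mult_sum inner_sum_right
        quadratic_form_congruence pos_semidef_def intro!: sum_nonneg divide_nonneg_nonneg)
next
  case Fisher
  then show ?thesis
    by (auto simp: scaleR_matrix_vector_assoc[symmetric] matrix_vector_mult_sum inner_sum_right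
        quadratic_form_columnvector_rowvector intro!: sum_nonneg divide_nonneg_nonneg)
qed

text \<open>The form of the damped matrix is at least \<open>lam * (x \<bullet> x)\<close>, so its
  kernel is trivial and it is invertible. Later arguments use this equation in place of the
  inverse.\<close>

lemma lm_direction_solves:
  fixes B :: "real^'n^'n"
  assumes psd: "\<And>x. 0 \<le> x \<bullet> (B *v x)" and lam: "0 < lam"
  shows "g = - (B *v lm_direction B lam g) - lam *\<^sub>R lm_direction B lam g"
proof -
  let ?A = "B + lam *\<^sub>R mat 1"
  have mult: "?A *v x = B *v x + lam *\<^sub>R x" for x
    by (simp add: matrix_vector_mult_add_rdistrib scaleR_matrix_vector_assoc[symmetric])
  have "x = 0" if "?A *v x = 0" for x
  proof -
    have "0 = x \<bullet> (?A *v x)" using that by simp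
    also have "\<dots> = x \<bullet> (B *v x) + lam * (x \<bullet> x)" by (simp add: mult inner_add_right)
    finally have "lam * (x \<bullet> x) \<le> 0" using psd[of x] by linarith
    then show ?thesis using lam by (simp add: mult_le_0_iff flip: power2_norm_eq_inner)
  qed
  then have "invertible ?A"
    by (metis invertible_left_inverse matrix_left_invertible_ker)
  then have "?A ** matrix_inv ?A = mat 1"
    unfolding invertible_def matrix_inv_def by (rule someI_ex[THEN conjunct1])
  then have "?A *v (matrix_inv ?A *v g) = g" by (simp only: matrix_vector_mul_assoc matrix_vector_mul_lid)
  then show ?thesis
    unfolding lm_direction_def mult by (simp add: linear_neg[OF matrix_vector_mul_linear])
qed

lemma model_reduction_eq:
  assumes "gradient f \<theta> = - (B *v p) - lam *\<^sub>R p"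
  shows "quadratic_model f B \<theta> 0 - quadratic_model f B \<theta> p
    = lam * (norm p)\<^sup>2 + (p \<bullet> (B *v p)) / 2"
  unfolding quadratic_model_def assms
  by (simp add: inner_diff_left inner_commute power2_norm_eq_inner algebra_simps)

text \<open>Converts a decrease measured by the step length into one measured by the
  gradient.\<close>

lemma norm_gradient_le_step:
  assumes "g = - (B *v p) - lam *\<^sub>R p" "spectral_norm B \<le> \<beta>" "0 \<le> lam"
  shows "norm g \<le> (\<beta> + lam) * norm p"
proof -
  have "norm g \<le> norm (B *v p) + norm (lam *\<^sub>R p)"
    unfolding assms(1) by (metis norm_minus_cancel norm_triangle_ineq4)
  also have "norm (B *v p) \<le> spectral_norm B * norm p"
    unfolding spectral_norm_def by (simp add: onorm matrix_vector_mul_bounded_linear)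
  also have "\<dots> \<le> \<beta> * norm p" using assms(2) by (simp add: mult_right_mono)
  finally show ?thesis using assms(3) by (simp add: algebra_simps)
qed

text \<open>The hypothesis \<open>g \<noteq> 0\<close> makes the denominator of \<open>\<rho>\<close> positive.\<close>

lemma reduction_ratio_ge_half:
  fixes f :: "real^'n \<Rightarrow> real"
  assumes psd: "0 \<le> p \<bullet> (B *v p)"
    and g: "gradient f \<theta> = - (B *v p) - lam *\<^sub>R p" "gradient f \<theta> \<noteq> 0"
    and descent: "f (\<theta> + p) \<le> f \<theta> + gradient f \<theta> \<bullet> p + L / 2 * (norm p)\<^sup>2"
    and lam: "0 < lam" "L \<le> lam"
  shows "1 / 2 \<le> reduction_ratio f B \<theta> p"
proof -
  let ?P = "lam * (norm p)\<^sup>2 + (p \<bullet> (B *v p)) / 2"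
  have "p \<noteq> 0" using g by auto
  then have P: "0 < ?P" using lam psd by (simp add: add_pos_nonneg)
  have "gradient f \<theta> \<bullet> p = - (p \<bullet> (B *v p)) - lam * (norm p)\<^sup>2"
    unfolding g(1) inner_commute[of _ p] by (simp add: inner_diff_right dot_square_norm)
  \<comment> \<open>Here \<open>L \<le> lam\<close> enters: the second-order remainder uses up at
    most half of the damping term. The other half and the full curvature term remain, which covers
    half of \<open>?P\<close>.\<close>
  moreover have "L / 2 * (norm p)\<^sup>2 \<le> lam * (norm p)\<^sup>2 / 2"
    using lam by (simp add: mult_right_mono)
  moreover have "1 / 2 * ?P = lam * (norm p)\<^sup>2 / 2 + (p \<bullet> (B *v p)) / 4"
    by (simp add: field_simps)
  ultimately have "1 / 2 * ?P \<le> f \<theta> - f (\<theta> + p)" using descent psd by linarith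
  then show ?thesis
    unfolding reduction_ratio_def model_reduction_eq[OF g(1)] using P by (simp only: pos_le_divide_eq)
qed

text \<open>Acceptance guarantees a fraction \<open>\<eta>\<close> of the predicted reduction, which
  is at least \<open>\<tau> * (norm p)\<^sup>2\<close>, and \<open>norm p\<close> is at least the
  gradient norm divided by \<open>\<beta> + \<Lambda>\<close>. Since \<open>lam\<close> enters only
  through its two bounds, the constant is the same for all iterations.\<close>

lemma accepted_step_decrease:
  fixes f :: "real^'n \<Rightarrow> real"
  assumes psd: "0 \<le> p \<bullet> (B *v p)"
    and g: "gradient f \<theta> = - (B *v p) - lam *\<^sub>R p" "gradient f \<theta> \<noteq> 0"
    and B: "spectral_norm B \<le> \<beta>"
    and lam: "0 < \<tau>" "\<tau> \<le> lam" "lam \<le> \<Lambda>"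
    and \<eta>: "0 < \<eta>" "\<eta> \<le> reduction_ratio f B \<theta> p"
  shows "\<eta> * \<tau> / (\<beta> + \<Lambda>)\<^sup>2 * (norm (gradient f \<theta>))\<^sup>2 \<le> f \<theta> - f (\<theta> + p)"
proof -
  let ?P = "lam * (norm p)\<^sup>2 + (p \<bullet> (B *v p)) / 2"
  have "p \<noteq> 0" using g by auto
  then have P: "0 < ?P" using lam psd by (simp add: add_pos_nonneg)
  \<comment> \<open>The sign of \<open>\<beta>\<close> is not assumed but follows from the norm it
    bounds.\<close>
  have "0 \<le> spectral_norm B"
    by (simp add: spectral_norm_def onorm_pos_le matrix_vector_mul_bounded_linear)
  then have pos: "0 < \<beta> + \<Lambda>" using B lam by linarith
  have "norm (gradient f \<theta>) \<le> (\<beta> + lam) * norm p"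
    using norm_gradient_le_step[OF g(1) B] lam by simp
  also have "\<dots> \<le> (\<beta> + \<Lambda>) * norm p" using lam by (simp add: mult_right_mono)
  finally have "(norm (gradient f \<theta>))\<^sup>2 \<le> (\<beta> + \<Lambda>)\<^sup>2 * (norm p)\<^sup>2"
    by (metis norm_ge_zero power_mono power_mult_distrib)
  then have "(norm (gradient f \<theta>))\<^sup>2 / (\<beta> + \<Lambda>)\<^sup>2 \<le> (norm p)\<^sup>2"
    using pos by (simp add: pos_divide_le_eq mult.commute)
  then have "\<tau> * ((norm (gradient f \<theta>))\<^sup>2 / (\<beta> + \<Lambda>)\<^sup>2) \<le> lam * (norm p)\<^sup>2"
    using lam by (intro mult_mono) auto
  also have "\<dots> \<le> ?P" using psd by simp
  finally have "\<eta> * (\<tau> * ((norm (gradient f \<theta>))\<^sup>2 / (\<beta> + \<Lambda>)\<^sup>2)) \<le> \<eta> * ?P"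
    using \<eta> by (simp only: mult_left_mono less_imp_le)
  also have "\<dots> \<le> f \<theta> - f (\<theta> + p)"
    using \<eta>(2) P unfolding reduction_ratio_def model_reduction_eq[OF g(1)]
    by (simp only: pos_le_divide_eq)
  finally show ?thesis by (simp add: mult_ac)
qed

section \<open>Convergence of damped iterations\<close>

lemma eventually_accepted:
  fixes lam :: "nat \<Rightarrow> real"
  assumes rej: "\<And>t. \<not> acc t \<Longrightarrow> lam (Suc t) = b * lam t" and b: "1 < b"
    and pos: "\<And>t. 0 < lam t" and bound: "\<And>t. lam t \<le> M"
  shows "\<exists>s\<ge>t. acc s"
proof (rule ccontr)
  assume "\<not> (\<exists>s\<ge>t. acc s)"
  then have rej': "lam (Suc (t + k)) = b * lam (t + k)" for k by (simp add: rej)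
  have growth: "lam (t + k) = b ^ k * lam t" for k
    by (induction k) (simp_all add: rej' mult_ac)
  obtain k where "M / lam t < b ^ k" using real_arch_pow[OF b] by blast
  then have "M < lam (t + k)" using pos[of t] by (simp add: growth divide_less_eq)
  with bound[of "t + k"] show False by simp
qed

text \<open>Every iteration, accepted or not, is compared with the gap between
  \<open>f (x t)\<close> and its limit. This gives convergence of the whole sequence and not merely
  of a subsequence.\<close>

lemma gradients_tendsto_0:
  fixes x :: "nat \<Rightarrow> 'a" and g :: "'a \<Rightarrow> 'b::real_normed_vector"
  assumes stay: "\<And>t. \<not> acc t \<Longrightarrow> x (Suc t) = x t"
    and decrease: "\<And>t. acc t \<Longrightarrow> c * (norm (g (x t)))\<^sup>2 \<le> f (x t) - f (x (Suc t))"
    and c: "0 < c" and bdd: "bdd_below (range f)" and infinite: "\<And>t. \<exists>s\<ge>t. acc s"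
  shows "(\<lambda>t. norm (g (x t))) \<longlonglongrightarrow> (0::real)"
proof -
  have step: "f (x (Suc t)) \<le> f (x t)" for t
  proof (cases "acc t")
    case True
    have "0 \<le> c * (norm (g (x t)))\<^sup>2" using c by simp
    with decrease[OF True] show ?thesis by linarith
  qed (simp add: stay)
  then have dec: "decseq (\<lambda>t. f (x t))" by (simp add: decseq_Suc_iff)
  obtain m where "\<And>z. m \<le> f z" using bdd by (auto simp: bdd_below_def)
  with dec obtain l where l: "(\<lambda>t. f (x t)) \<longlonglongrightarrow> l" "\<And>t. l \<le> f (x t)"
    using decseq_convergent[of "\<lambda>t. f (x t)" m] by blast
  have bound: "(norm (g (x t)))\<^sup>2 \<le> (f (x t) - l) / c" for t
  proof -
    \<comment> \<open>With \<open>s\<close> the first acceptance from \<open>t\<close> on, all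
      iterations in between are rejected, so the point at \<open>s\<close> is still
      \<open>x t\<close> and the decrease at \<open>s\<close> is at most
      \<open>f (x t) - l\<close>.\<close>
    define s where "s = (LEAST s. t \<le> s \<and> acc s)"
    have s: "t \<le> s" "acc s" using LeastI_ex[OF infinite[of t]] unfolding s_def by (auto simp: conj_commute)
    have rej: "\<not> acc r" if "t \<le> r" "r < s" for r using not_less_Least that unfolding s_def by blast
    have "x r = x t" if "t \<le> r" "r \<le> s" for r
      using that by (induction r rule: dec_induct) (auto simp: stay rej)
    with s have "x s = x t" by blast
    with decrease[OF s(2)] l(2)[of "Suc s"] show ?thesis
      using c by (simp add: pos_le_divide_eq mult.commute)
  qed
  have "(\<lambda>t. (f (x t) - l) / c) \<longlonglongrightarrow> (l - l) / c"
    using c by (intro tendsto_intros l(1)) auto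
  then have "(\<lambda>t. (f (x t) - l) / c) \<longlonglongrightarrow> 0" by simp
  then have "(\<lambda>t. (norm (g (x t)))\<^sup>2) \<longlonglongrightarrow> 0"
    by (rule Lim_null_comparison[rotated]) (use bound in simp)
  then show ?thesis by (simp add: power_tendsto_0_iff)
qed

theorem theorem1:
  fixes yhat :: "nat \<Rightarrow> real^'n \<Rightarrow> real^'m"
    and loss :: "real^'m \<Rightarrow> 'y \<Rightarrow> real"
    and y :: "nat \<Rightarrow> 'y"
    and N N2 :: nat
    and f :: "real^'n \<Rightarrow> real"
    and kind :: curvature
    and S :: "nat \<Rightarrow> nat set"
    and B :: "nat \<Rightarrow> real^'n^'n"
    and \<theta> :: "nat \<Rightarrow> real^'n"
    and lamLM :: "nat \<Rightarrow> real"
    and \<epsilon> \<eta> \<tau> shrink boost \<beta> \<beta>1 :: real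
  assumes f_def: "f = objective yhat loss y N"
    and f_twice_diff: "\<And>x. twice_differentiable_at f x"
    and regular: "\<And>i x. i \<in> {1..N} \<Longrightarrow> curvature_regular kind yhat loss y i x"
    and parameters: "0 < \<epsilon>" "\<epsilon> < 1/2" "0 < \<eta>" "\<eta> < \<epsilon>" "0 < \<tau>" "0 < shrink" "shrink < 1" "1 < boost"
    and sizes: "0 < N" "0 < N2"
    and batches: "\<And>t. S t \<subseteq> {1..N}" "\<And>t. card (S t) = N2"
    and B_def: "\<And>t. B t = curvature_matrix kind yhat loss y (S t) (\<theta> t)"
    and loss_psd: "\<And>t i. kind = Gauss_Newton \<Longrightarrow> i \<in> S t \<Longrightarrow>
                     pos_semidef (output_hessian yhat loss y i (\<theta> t))"
    and run: "lm_run \<epsilon> \<eta> \<tau> shrink boost f B \<theta> lamLM"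
    and B_bound: "\<And>t. spectral_norm (B t) \<le> \<beta>"
    and hessian_bound: "\<And>x. spectral_norm (hessian f x) \<le> \<beta>1"
    and f_bdd_below: "bdd_below (range f)"
    and never_stops: "\<And>t. gradient f (\<theta> t) \<noteq> 0"
  shows "(\<lambda>t. norm (gradient f (\<theta> t))) \<longlonglongrightarrow> 0"
proof -
  define p where "p t = lm_direction (B t) (lamLM t + \<tau>) (gradient f (\<theta> t))" for t
  define \<rho> where "\<rho> t = reduction_ratio f (B t) (\<theta> t) (p t)" for t
  have lam_Suc: "lamLM (Suc t) = update_damping \<epsilon> shrink boost (\<rho> t) (lamLM t)"
    and \<theta>_Suc: "\<theta> (Suc t) = (if \<rho> t \<ge> \<eta> then \<theta> t + p t else \<theta> t)" for t
    using run never_stops unfolding lm_run_def p_def \<rho>_def by (simp_all add: Let_def)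
  have lam_pos: "0 < lamLM t" for t
  proof (induction t)
    case 0
    show ?case using run by (simp add: lm_run_def)
  next
    case (Suc t)
    then show ?case using parameters by (simp add: lam_Suc update_damping_def)
  qed
  have psd: "0 \<le> x \<bullet> (B t *v x)" for t x
    unfolding B_def by (rule curvature_matrix_nonneg) (rule loss_psd)
  have g_eq: "gradient f (\<theta> t) = - (B t *v p t) - (lamLM t + \<tau>) *\<^sub>R p t" for t
    unfolding p_def by (rule lm_direction_solves) (use psd lam_pos[of t] parameters in auto)
  have "f differentiable (at x)" for x
    using f_twice_diff[of x] eventually_nhds_x_imp_x unfolding twice_differentiable_at_def by blast
  then have descent: "f (x + q) \<le> f x + gradient f x \<bullet> q + \<beta>1 / 2 * (norm q)\<^sup>2" for x q
    using gradient_lipschitz[OF f_twice_diff hessian_bound] by (rule descent_lemma)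
  \<comment> \<open>The damping can rise only while \<open>lamLM t + \<tau> < \<beta>1\<close>, and
    one boost from there ends below \<open>boost * \<beta>1\<close>; the other term covers the
    initial value.\<close>
  define M where "M = max (lamLM 0) (boost * \<beta>1)"
  have lam_le: "lamLM t \<le> M" for t
  proof (induction t)
    case (Suc t)
    show ?case
    proof (cases "\<beta>1 \<le> lamLM t + \<tau>")
      case True
      then have "1 / 2 \<le> \<rho> t"
        unfolding \<rho>_def using lam_pos[of t] parameters
        by (intro reduction_ratio_ge_half[OF psd g_eq never_stops descent]) auto
      \<comment> \<open>Because \<open>\<epsilon> < 1/2\<close>, a ratio of at least
        \<open>1 / 2\<close> rules out the boosting branch.\<close>
      then have "lamLM (Suc t) \<le> lamLM t"
        using parameters lam_pos[of t] by (simp add: lam_Suc update_damping_def)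
      with Suc show ?thesis by simp
    next
      case False
      have "lamLM (Suc t) \<le> boost * lamLM t"
        using parameters lam_pos[of t] by (simp add: lam_Suc update_damping_def)
      also have "\<dots> \<le> boost * \<beta>1" using False parameters by (intro mult_left_mono) auto
      finally show ?thesis by (simp add: M_def)
    qed
  qed (simp add: M_def)
  \<comment> \<open>The damping used in the step is \<open>lamLM t + \<tau>\<close>, which lies
    between \<open>\<tau>\<close> and \<open>M + \<tau>\<close>; the latter serves as
    \<open>\<Lambda>\<close>.\<close>
  define c where "c = \<eta> * \<tau> / (\<beta> + (M + \<tau>))\<^sup>2"
  have "0 \<le> spectral_norm (B 0)"
    by (simp add: spectral_norm_def onorm_pos_le matrix_vector_mul_bounded_linear)
  then have "0 < \<beta> + (M + \<tau>)" using B_bound[of 0] lam_pos[of 0] lam_le[of 0] parameters by linarith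
  then have "0 < c" using parameters by (simp add: c_def)
  show ?thesis
  proof (rule gradients_tendsto_0[where acc = "\<lambda>t. \<eta> \<le> \<rho> t" and x = \<theta> and f = f and c = c])
    show "c * (norm (gradient f (\<theta> t)))\<^sup>2 \<le> f (\<theta> t) - f (\<theta> (Suc t))" if "\<eta> \<le> \<rho> t" for t
    proof -
      have "c * (norm (gradient f (\<theta> t)))\<^sup>2 \<le> f (\<theta> t) - f (\<theta> t + p t)"
        unfolding c_def using that lam_pos[of t] lam_le[of t] parameters
        by (intro accepted_step_decrease[OF psd g_eq never_stops B_bound]) (auto simp: \<rho>_def)
      with that show ?thesis by (simp add: \<theta>_Suc)
    qed
    \<comment> \<open>This is where \<open>\<eta> < \<epsilon>\<close> matters: a rejected step has
      a ratio below \<open>\<epsilon>\<close> and therefore always boosts the damping.\<close>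
    show "\<exists>s\<ge>t. \<eta> \<le> \<rho> s" for t
      by (rule eventually_accepted[where lam = lamLM and b = boost and M = M])
        (use parameters lam_pos lam_le in \<open>auto simp: lam_Suc update_damping_def\<close>)
  qed (use f_bdd_below \<open>0 < c\<close> in \<open>auto simp: \<theta>_Suc\<close>)
qed

end
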